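(* Let $X$ be a set, $E$ a nonempty set of parameters, $N\ge 1$ an integer, and let $(X,\mathcal{T}_i,N,E)$ be a soft $N$-topological space over $X$, with soft topologies $\mathcal{T}_1,\dots,\mathcal{T}_N$. Then, for every parameter $e\in E$, the structure $(X,\mathcal{T}_{1,e},\dots,\mathcal{T}_{N,e})$, where $\mathcal{T}_{i,e}=\{F(e) : (F,E)\in\mathcal{T}_i\}$ for $i=1,\dots,N$, is an $N$-topological space.
   Context: A soft set over $X$ (with respect to the fixed nonempty parameter set $E$) is a pair $(F,E)$ where $F:E\to\mathcal{P}(X)$ is any map. The null soft set has $F(e)=\emptyset$ for all $e$; the absolute soft set has $F(e)=X$ for all $e$. Soft unions and soft intersections are defined parameterwise: the soft union of $\{(F_i,E)\}_{i\in I}$ is given by $e\mapsto\bigcup_i F_i(e)$ and the soft intersection of $(F,E)$ and $(G,E)$ by $e\mapsto F(e)\cap G(e)$. A soft topology on $X$ with respect to $E$ is a family $\mathcal{T}$ of soft sets over $X$ that contains the null soft set and the absolute soft set, and is closed under soft intersections of two members and under arbitrary soft unions. A soft $N$-topological space $(X,\mathcal{T}_i,N,E)$ over $X$ is the set $X$ equipped with $N$ different soft topologies $\mathcal{T}_1,\dots,\mathcal{T}_N$ on $X$ with respect to the same $E$. An (ordinary, crisp) $N$-topological space is the ordinary counterpart of this notion: a set $X$ equipped with $N$ different (ordinary) topologies on $X$.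
   Formalization: The N topologies are not required to be different, either in the soft N-topological space or in the resulting N-topological space; with "different" read literally the claim fails, since distinct soft topologies can give the same topology at a parameter. *)

theory Defs
  imports "HOL-Analysis.Abstract_Topology"
begin

(* A soft set (F,E) over X is represented by the map F alone, E being fixed. Maps on E are
   extensional functions, so that equality of soft sets is equality of functions. *)
definition soft_sets :: "'e set \<Rightarrow> 'a set \<Rightarrow> ('e \<Rightarrow> 'a set) set" where
  "soft_sets E X = E \<rightarrow>\<^sub>E Pow X"

definition null_soft_set :: "'e set \<Rightarrow> 'e \<Rightarrow> 'a set" where
  "null_soft_set E = (\<lambda>e\<in>E. {})"

definition absolute_soft_set :: "'e set \<Rightarrow> 'a set \<Rightarrow> 'e \<Rightarrow> 'a set" where
  "absolute_soft_set E X = (\<lambda>e\<in>E. X)"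

definition soft_Union :: "'e set \<Rightarrow> ('e \<Rightarrow> 'a set) set \<Rightarrow> 'e \<Rightarrow> 'a set" where
  "soft_Union E \<F> = (\<lambda>e\<in>E. \<Union>F\<in>\<F>. F e)"

definition soft_inter :: "'e set \<Rightarrow> ('e \<Rightarrow> 'a set) \<Rightarrow> ('e \<Rightarrow> 'a set) \<Rightarrow> 'e \<Rightarrow> 'a set" where
  "soft_inter E F G = (\<lambda>e\<in>E. F e \<inter> G e)"

definition soft_topology_on :: "'e set \<Rightarrow> 'a set \<Rightarrow> ('e \<Rightarrow> 'a set) set \<Rightarrow> bool" where
  "soft_topology_on E X \<T> \<longleftrightarrow>
     \<T> \<subseteq> soft_sets E X \<and>
     null_soft_set E \<in> \<T> \<and>
     absolute_soft_set E X \<in> \<T> \<and>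
     (\<forall>F\<in>\<T>. \<forall>G\<in>\<T>. soft_inter E F G \<in> \<T>) \<and>
     (\<forall>\<F>\<subseteq>\<T>. soft_Union E \<F> \<in> \<T>)"

(* Both N-topological notions are families indexed by 1, ..., N whose members may coincide.
   Pairwise distinctness is not part of either notion: it is not inherited by the families
   obtained at a parameter, as distinct soft topologies can have the same sets at e. *)
definition soft_N_topological_space ::
    "'a set \<Rightarrow> (nat \<Rightarrow> ('e \<Rightarrow> 'a set) set) \<Rightarrow> nat \<Rightarrow> 'e set \<Rightarrow> bool" where
  "soft_N_topological_space X \<T> N E \<longleftrightarrow> (\<forall>i\<in>{1..N}. soft_topology_on E X (\<T> i))"

(* The second conjunct says that the underlying set (topspace) is X; with the first it gives
   X \<in> \<tau>. *)
definition topology_on :: "'a set \<Rightarrow> 'a set set \<Rightarrow> bool" where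
  "topology_on X \<tau> \<longleftrightarrow> istopology (\<lambda>U. U \<in> \<tau>) \<and> \<Union>\<tau> = X"

definition N_topological_space :: "'a set \<Rightarrow> (nat \<Rightarrow> 'a set set) \<Rightarrow> nat \<Rightarrow> bool" where
  "N_topological_space X \<tau> N \<longleftrightarrow> (\<forall>i\<in>{1..N}. topology_on X (\<tau> i))"

definition parameter_topology :: "('e \<Rightarrow> 'a set) set \<Rightarrow> 'e \<Rightarrow> 'a set set" where
  "parameter_topology \<T> e = {F e | F. F \<in> \<T>}"

end

theory Submission
  imports Defs
begin

text \<open>
  Soft unions and intersections are formed parameterwise, so evaluation at a parameter \<open>e\<close>
  commutes with both, and it sends the null and the absolute soft set to \<open>{}\<close> and \<open>X\<close>. The image
  of a soft topology under evaluation at \<open>e\<close> is therefore a topology on \<open>X\<close>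
  (\<open>topology_on_parameter_topology\<close>); the claim for \<open>N\<close> soft topologies is this fact applied to
  each of them.
\<close>

lemma parameter_topology_eq_image: "parameter_topology \<T> e = (\<lambda>F. F e) ` \<T>"
  unfolding parameter_topology_def by blast

lemma topology_on_parameter_topology:
  assumes soft: "soft_topology_on E X \<T>" and e: "e \<in> E"
  shows "topology_on X (parameter_topology \<T> e)"
proof -
  have inter: "S \<inter> T \<in> parameter_topology \<T> e"
    if ST: "S \<in> parameter_topology \<T> e" "T \<in> parameter_topology \<T> e" for S T
  proof -
    obtain F G where FG: "F \<in> \<T>" "G \<in> \<T>" "S = F e" "T = G e"
      using ST unfolding parameter_topology_eq_image by blast
    have "soft_inter E F G \<in> \<T>"
      using soft FG unfolding soft_topology_on_def by blast
    moreover have "S \<inter> T = soft_inter E F G e"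
      using FG e by (simp add: soft_inter_def)
    ultimately show ?thesis
      unfolding parameter_topology_eq_image by (simp add: image_eqI)
  qed
  have Union: "\<Union>\<K> \<in> parameter_topology \<T> e" if \<K>: "\<K> \<subseteq> parameter_topology \<T> e" for \<K>
  proof -
    \<comment> \<open>Several soft sets can have the same value at \<open>e\<close>; any family with values \<open>\<K>\<close> will do,
      as its soft union has the value \<open>\<Union>\<K>\<close> at \<open>e\<close>.\<close>
    obtain \<F> where \<F>: "\<F> \<subseteq> \<T>" "\<K> = (\<lambda>F. F e) ` \<F>"
      using \<K> unfolding parameter_topology_eq_image subset_image_iff by blast
    have "soft_Union E \<F> \<in> \<T>"
      using soft \<F> unfolding soft_topology_on_def by blast
    moreover have "\<Union>\<K> = soft_Union E \<F> e"
      using \<F> e by (simp add: soft_Union_def)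
    ultimately show ?thesis
      unfolding parameter_topology_eq_image by (simp add: image_eqI)
  qed
  have "F e \<subseteq> X" if "F \<in> \<T>" for F
    using soft that e unfolding soft_topology_on_def soft_sets_def by (auto dest: PiE_mem)
  moreover have "absolute_soft_set E X \<in> \<T>" "absolute_soft_set E X e = X"
    using soft e by (simp_all add: soft_topology_on_def absolute_soft_set_def)
  ultimately have "\<Union>(parameter_topology \<T> e) = X"
    unfolding parameter_topology_eq_image by blast
  then show ?thesis
    using inter Union by (simp add: topology_on_def istopology_def subset_eq)
qed

theorem proposition4p2:
  fixes X :: "'a set" and E :: "'e set" and N :: nat
    and \<T> :: "nat \<Rightarrow> ('e \<Rightarrow> 'a set) set"
  assumes "E \<noteq> {}"
    and "N \<ge> 1"
    and "soft_N_topological_space X \<T> N E"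
  shows "\<forall>e\<in>E. N_topological_space X (\<lambda>i. parameter_topology (\<T> i) e) N"
proof
  fix e assume "e \<in> E"
  then show "N_topological_space X (\<lambda>i. parameter_topology (\<T> i) e) N"
    using assms(3) topology_on_parameter_topology
    unfolding soft_N_topological_space_def N_topological_space_def by fast
qed

end
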